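(* If $G$ is a bridgeless graph, then $\phi_2(G) \le 1+\sqrt{5}$.
   Context: For a real number $r \ge 2$ and a positive integer $d$, a $d$-dimensional nowhere-zero $r$-flow ($(r,d)$-NZF) on a graph $G$ is an orientation of $G$ together with a map $\varphi\colon E(G)\to\mathbb{R}^d$ such that the Euclidean norm of $\varphi(e)$ lies in $[1,r-1]$ for every edge $e$, and at every vertex the sum of the values on outgoing edges equals the sum of the values on incoming edges. For a bridgeless graph $G$, $\phi_d(G)$ is the infimum of all real $r\ge 2$ such that $G$ admits an $(r,d)$-NZF. *)

theory Defs
  imports "HOL-Analysis.Analysis" "Graph_Theory.Digraph"
begin

text \<open>
  Undirected multigraphs: parallel edges and loops are allowed; a loop is an edge whose set of
  ends is a singleton.
\<close>

record ('v, 'e) multigraph =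
  vertices :: "'v set"
  edges :: "'e set"
  ends :: "'e \<Rightarrow> 'v set"

definition finite_multigraph :: "('v, 'e) multigraph \<Rightarrow> bool" where
  "finite_multigraph G \<longleftrightarrow>
     finite (vertices G) \<and> finite (edges G) \<and>
     (\<forall>e\<in>edges G. \<exists>u\<in>vertices G. \<exists>v\<in>vertices G. ends G e = {u, v})"

definition adjacency :: "('v, 'e) multigraph \<Rightarrow> ('v \<times> 'v) set" where
  "adjacency G = {(u, v). \<exists>e\<in>edges G. ends G e = {u, v}}"

definition delete_edge :: "'e \<Rightarrow> ('v, 'e) multigraph \<Rightarrow> ('v, 'e) multigraph" where
  "delete_edge e G = G\<lparr>edges := edges G - {e}\<rparr>"

text \<open>A bridge is an edge whose ends lie in different components once it is deleted.\<close>

definition bridge :: "('v, 'e) multigraph \<Rightarrow> 'e \<Rightarrow> bool" where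
  "bridge G e \<longleftrightarrow>
     e \<in> edges G \<and>
     (\<exists>u v. ends G e = {u, v} \<and> (u, v) \<notin> (adjacency (delete_edge e G))\<^sup>*)"

definition bridgeless :: "('v, 'e) multigraph \<Rightarrow> bool" where
  "bridgeless G \<longleftrightarrow> (\<forall>e\<in>edges G. \<not> bridge G e)"

definition orientation_of :: "('v, 'e) multigraph \<Rightarrow> ('v, 'e) pre_digraph \<Rightarrow> bool" where
  "orientation_of G D \<longleftrightarrow>
     verts D = vertices G \<and> arcs D = edges G \<and>
     (\<forall>e\<in>edges G. ends G e = {tail D e, head D e})"

text \<open>The dimension of the flow is the cardinality of the index type \<open>'d\<close>.\<close>

definition nowhere_zero_flow ::
  "real \<Rightarrow> ('v, 'e) multigraph \<Rightarrow> ('v, 'e) pre_digraph \<Rightarrow> ('e \<Rightarrow> real ^ 'd) \<Rightarrow> bool" where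
  "nowhere_zero_flow r G D \<phi> \<longleftrightarrow>
     orientation_of G D \<and>
     (\<forall>e\<in>edges G. norm (\<phi> e) \<in> {1..r - 1}) \<and>
     (\<forall>v\<in>vertices G. sum \<phi> (out_arcs D v) = sum \<phi> (in_arcs D v))"

text \<open>
  The infimum is taken in the extended reals, so that it is infinity, and not an unspecified
  real number, for a graph that admits no flow at all.
\<close>

definition flow_number :: "'d::finite itself \<Rightarrow> ('v, 'e) multigraph \<Rightarrow> ereal" where
  "flow_number _ G =
     Inf (ereal ` {r. 2 \<le> r \<and>
       (\<exists>(D :: ('v, 'e) pre_digraph) (\<phi> :: 'e \<Rightarrow> real ^ 'd). nowhere_zero_flow r G D \<phi>)})"

end

theory Submission
  imports Defs
begin

text \<open>
  By Seymour's 6-flow theorem a bridgeless graph carries a flow modulo 2 and a flow modulo 3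
  without a common zero. Tutte's lifting turns them into integer flows \<open>f\<close> and \<open>g\<close> with
  \<open>\<bar>f\<bar> \<le> 1\<close> and \<open>\<bar>g\<bar> \<le> 2\<close>, so that the plane flow \<open>(f, g)\<close> has norms in \<open>{1..sqrt 5}\<close>.

  For Seymour's theorem, 2-edge-cuts are contracted away, and a vertex set \<open>U\<close> is grown on which
  the flow modulo 2 has been chosen and the flow modulo 3 can still be completed. The set is enlarged
  by an even subgraph outside \<open>U\<close> that is joined to \<open>U\<close> by two edges: a value on one of these edges
  determines the value on the other, and of the three residues at most two are excluded.
\<close>

section \<open>Net outflow and cuts of a finite directed multigraph\<close>

locale finite_arcs =
  fixes E :: "'e set" and src tgt :: "'e \<Rightarrow> 'v"
  assumes finite_E: "finite E"
begin

text \<open>Values are integers throughout: a flow modulo \<open>m\<close> is an \<open>f\<close>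
  with \<open>m dvd net_out f {v}\<close> for all \<open>v\<close>, so that residues and their
  integer lifts share one notion.\<close>

definition net_out :: "('e \<Rightarrow> int) \<Rightarrow> 'v set \<Rightarrow> int" where
  "net_out f X = (\<Sum>e\<in>E. f e * (of_bool (src e \<in> X) - of_bool (tgt e \<in> X)))"

definition cut :: "'v set \<Rightarrow> 'e set" where
  "cut X = {e \<in> E. (src e \<in> X) \<noteq> (tgt e \<in> X)}"

definition inner :: "'v set \<Rightarrow> 'e set" where
  "inner X = {e \<in> E. src e \<in> X \<and> tgt e \<in> X}"

definition between :: "'v set \<Rightarrow> 'v set \<Rightarrow> 'e set" where
  "between X Y = {e \<in> E. src e \<in> X \<and> tgt e \<in> Y \<or> src e \<in> Y \<and> tgt e \<in> X}"

lemma finite_cut [simp]: "finite (cut X)"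
  using finite_E by (simp add: cut_def)

lemma finite_between [simp]: "finite (between X Y)"
  using finite_E by (simp add: between_def)

lemma net_out_add: "net_out (\<lambda>e. f e + g e) X = net_out f X + net_out g X"
  by (simp add: net_out_def distrib_right sum.distrib)

lemma net_out_diff: "net_out (\<lambda>e. f e - g e) X = net_out f X - net_out g X"
  by (simp add: net_out_def left_diff_distrib sum_subtractf)

lemma net_out_scale: "net_out (\<lambda>e. c * f e) X = c * net_out f X"
  by (simp add: net_out_def sum_distrib_left algebra_simps)

lemma net_out_zero [simp]: "net_out (\<lambda>e. 0) X = 0"
  by (simp add: net_out_def)

lemma net_out_sum: "net_out (\<lambda>e. \<Sum>z\<in>A. f z e) X = (\<Sum>z\<in>A. net_out (f z) X)"
  unfolding net_out_def sum_distrib_right by (rule sum.swap)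

lemma net_out_cong:
  assumes "\<And>e. e \<in> cut X \<Longrightarrow> f e = g e"
  shows "net_out f X = net_out g X"
  unfolding net_out_def using assms by (intro sum.cong) (auto simp: cut_def)

lemma net_out_eq_0:
  assumes "\<And>e. e \<in> cut X \<Longrightarrow> f e = 0"
  shows "net_out f X = 0"
  using net_out_cong[of X f "\<lambda>e. 0"] assms by simp

lemma sum_net_out:
  assumes "finite X"
  shows "(\<Sum>v\<in>X. net_out f {v}) = net_out f X"
proof -
  have ind: "(\<Sum>v\<in>X. of_bool (u = v)) = (of_bool (u \<in> X) :: int)" for u
    using assms by (simp add: of_bool_def)
  have "(\<Sum>v\<in>X. net_out f {v})
      = (\<Sum>e\<in>E. \<Sum>v\<in>X. f e * (of_bool (src e = v) - of_bool (tgt e = v)))"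
    unfolding net_out_def by (subst sum.swap) simp
  also have "\<dots> = net_out f X"
    unfolding net_out_def sum_distrib_left[symmetric] sum_subtractf ind ..
  finally show ?thesis .
qed

lemma net_out_Un:
  assumes "X \<inter> Y = {}"
  shows "net_out f (X \<union> Y) = net_out f X + net_out f Y"
proof -
  have "of_bool (u \<in> X \<union> Y) = (of_bool (u \<in> X) + of_bool (u \<in> Y) :: int)" for u
    using assms by auto
  then show ?thesis
    by (simp add: net_out_def sum.distrib[symmetric] algebra_simps)
qed

lemma net_out_single:
  assumes "e0 \<in> E"
  shows "net_out (\<lambda>e. if e = e0 then c else 0) X
    = c * (of_bool (src e0 \<in> X) - of_bool (tgt e0 \<in> X))"
proof -
  have "net_out (\<lambda>e. if e = e0 then c else 0) X
      = (\<Sum>e\<in>E. if e = e0 then c * (of_bool (src e0 \<in> X) - of_bool (tgt e0 \<in> X)) else 0)"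
    unfolding net_out_def by (intro sum.cong) auto
  then show ?thesis using assms finite_E by simp
qed

section \<open>Augmenting paths and two arc-disjoint paths\<close>

text \<open>A path from \<open>x\<close> to \<open>z\<close> is represented by its unit flow, so
  that it can be added to other flows; traversing an arc of \<open>B\<close> backwards gives the
  value -1.\<close>

definition unit_path ::
  "'e set \<Rightarrow> 'e set \<Rightarrow> 'v set \<Rightarrow> 'v \<Rightarrow> 'v \<Rightarrow> ('e \<Rightarrow> int) \<Rightarrow> bool" where
  "unit_path F B S x z q \<longleftrightarrow>
     (\<forall>e. q e \<in> {-1, 0, 1} \<and> (q e \<noteq> 0 \<longrightarrow> e \<in> inner S) \<and> (q e = 1 \<longrightarrow> e \<in> F) \<and> (q e = -1 \<longrightarrow> e \<in> B)) \<and>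
     (\<forall>v. net_out q {v} = of_bool (v = x) - of_bool (v = z))"

lemma unit_pathD:
  assumes "unit_path F B S x z q"
  shows "q e \<in> {-1, 0, 1}" "q e \<noteq> 0 \<Longrightarrow> e \<in> inner S" "q e = 1 \<Longrightarrow> e \<in> F" "q e = -1 \<Longrightarrow> e \<in> B"
    "net_out q {v} = of_bool (v = x) - of_bool (v = z)"
  using assms unfolding unit_path_def by blast+

text \<open>The set of vertices reached from \<open>x\<close> along arcs of \<open>F\<close> (forwards) and \<open>B\<close> (backwards).
  Confining the path to \<open>z\<close> to the vertices reached so far keeps each arc from being used twice,
  so that the unit flow along it has values in \<open>{-1, 0, 1}\<close>.\<close>

lemma reachable_set:
  assumes "F \<subseteq> E" "B \<subseteq> E"
  obtains S where "x \<in> S" "S \<subseteq> insert x (src ` (F \<union> B) \<union> tgt ` (F \<union> B))" "finite S"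
    "\<And>e. e \<in> F \<Longrightarrow> src e \<in> S \<Longrightarrow> tgt e \<in> S"
    "\<And>e. e \<in> B \<Longrightarrow> tgt e \<in> S \<Longrightarrow> src e \<in> S"
    "\<And>z. z \<in> S \<Longrightarrow> \<exists>q. unit_path F B S x z q"
proof -
  define W where "W = insert x (src ` (F \<union> B) \<union> tgt ` (F \<union> B))"
  have "finite W"
    unfolding W_def using assms finite_E by (auto intro: finite_subset)
  define P where "P S \<longleftrightarrow> x \<in> S \<and> S \<subseteq> W \<and> (\<forall>z\<in>S. \<exists>q. unit_path F B S x z q)" for S
  have "unit_path F B {x} x x (\<lambda>e. 0)"
    by (simp add: unit_path_def)
  then have "P {x}" by (auto simp: P_def W_def)
  have "\<exists>S. P S \<and> (\<forall>S'. P S' \<longrightarrow> S \<subseteq> S' \<longrightarrow> S' = S)"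
  proof -
    have "finite {S. P S}"
      by (rule finite_subset[of _ "Pow W"]) (auto simp: P_def \<open>finite W\<close>)
    from finite_has_maximal[OF this] \<open>P {x}\<close> show ?thesis by blast
  qed
  then obtain S where S: "P S" and max: "\<And>S'. P S' \<Longrightarrow> S \<subseteq> S' \<Longrightarrow> S' = S" by blast
  have mono: "unit_path F B S' x z q" if "unit_path F B S x z q" "S \<subseteq> S'" for S S' z q
    using that by (auto simp: unit_path_def inner_def)
  have step: "z' \<in> S"
    if e: "e0 \<in> E" and c: "c = 1 \<and> e0 \<in> F \<and> z = src e0 \<and> z' = tgt e0
      \<or> c = -1 \<and> e0 \<in> B \<and> z = tgt e0 \<and> z' = src e0" and "z \<in> S" for e0 z z' and c :: int
  proof (rule ccontr)
    assume "z' \<notin> S"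
    from S \<open>z \<in> S\<close> obtain q where "unit_path F B S x z q"
      unfolding P_def by blast
    note q = unit_pathD[OF this]
    define q' where "q' = (\<lambda>e. q e + (if e = e0 then c else 0))"
    have q0: "q e0 = 0" using q(2)[of e0] c \<open>z' \<notin> S\<close> by (auto simp: inner_def)
    have "net_out q' {v} = of_bool (v = x) - of_bool (v = z')" for v
      unfolding q'_def net_out_add net_out_single[OF e] q(5) using c by auto
    moreover have "q' e \<in> {-1, 0, 1} \<and> (q' e \<noteq> 0 \<longrightarrow> e \<in> inner (insert z' S))
        \<and> (q' e = 1 \<longrightarrow> e \<in> F) \<and> (q' e = -1 \<longrightarrow> e \<in> B)" for e
    proof (cases "e = e0")
      case True
      then show ?thesis using q0 c e \<open>z \<in> S\<close> by (auto simp: q'_def inner_def)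
    next
      case False
      then show ?thesis using q(1-4)[of e] by (auto simp: q'_def inner_def)
    qed
    ultimately have "unit_path F B (insert z' S) x z' q'" by (simp add: unit_path_def)
    moreover have "z' \<in> W" using c by (auto simp: W_def)
    ultimately have "P (insert z' S)"
      using S mono[OF _ subset_insertI] unfolding P_def by (metis insert_iff insert_subset subset_insertI2)
    from max[OF this] \<open>z' \<notin> S\<close> show False by blast
  qed
  show thesis
  proof (rule that[of S])
    show "x \<in> S" "S \<subseteq> insert x (src ` (F \<union> B) \<union> tgt ` (F \<union> B))"
      using S by (auto simp: P_def W_def)
    show "finite S" using S \<open>finite W\<close> finite_subset by (auto simp: P_def)
    show "tgt e \<in> S" if "e \<in> F" "src e \<in> S" for e
      using step[of e 1 "src e" "tgt e"] that assms by blast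
    show "src e \<in> S" if "e \<in> B" "tgt e \<in> S" for e
      using step[of e "-1" "tgt e" "src e"] that assms by blast
    show "\<exists>q. unit_path F B S x z q" if "z \<in> S" for z
      using S that unfolding P_def by blast
  qed
qed

text \<open>One Ford-Fulkerson step, where each arc of \<open>A\<close> has capacity 1 in both
  directions. If \<open>y\<close> were not reachable in the residual graph, every arc of
  \<open>A\<close> across the reachable set \<open>S\<close> would carry one unit out of
  \<open>S\<close>. The outflow \<open>k\<close> of \<open>S\<close> would then be the size of that
  cut, which exceeds \<open>k\<close>.\<close>

lemma augment:
  fixes k :: nat
  assumes "A \<subseteq> E"
    and p: "\<And>e. p e \<in> {-1, 0, 1}" "\<And>e. p e \<noteq> 0 \<Longrightarrow> e \<in> A"
      "\<And>v. net_out p {v} = int k * (of_bool (v = x) - of_bool (v = y))"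
    and cuts: "\<And>S. x \<in> S \<Longrightarrow> y \<notin> S \<Longrightarrow> card (cut S \<inter> A) > k"
  shows "\<exists>p'. (\<forall>e. p' e \<in> {-1, 0, 1} \<and> (p' e \<noteq> 0 \<longrightarrow> e \<in> A))
    \<and> (\<forall>v. net_out p' {v} = int (Suc k) * (of_bool (v = x) - of_bool (v = y)))"
proof -
  obtain S where S: "x \<in> S" "finite S"
    "\<And>e. e \<in> {e\<in>A. p e \<le> 0} \<Longrightarrow> src e \<in> S \<Longrightarrow> tgt e \<in> S"
    "\<And>e. e \<in> {e\<in>A. p e \<ge> 0} \<Longrightarrow> tgt e \<in> S \<Longrightarrow> src e \<in> S"
    "\<And>z. z \<in> S \<Longrightarrow> \<exists>q. unit_path {e\<in>A. p e \<le> 0} {e\<in>A. p e \<ge> 0} S x z q"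
    by (rule reachable_set[of "{e\<in>A. p e \<le> 0}" "{e\<in>A. p e \<ge> 0}" x]) (use assms(1) in blast)+
  have "y \<in> S"
  proof (rule ccontr)
    assume "y \<notin> S"
    have "p e * (of_bool (src e \<in> S) - of_bool (tgt e \<in> S)) = of_bool (e \<in> cut S \<inter> A)"
      if "e \<in> E" for e
      using S(3,4)[of e] p(1,2)[of e] that by (auto simp: cut_def)
    then have "net_out p S = (\<Sum>e\<in>E. of_bool (e \<in> cut S \<inter> A))"
      unfolding net_out_def by (intro sum.cong) auto
    also have "\<dots> = int (card (E \<inter> (cut S \<inter> A)))"
      using finite_E by (simp add: of_bool_def sum.If_cases Int_def)
    also have "E \<inter> (cut S \<inter> A) = cut S \<inter> A"
      by (auto simp: cut_def)
    finally have "net_out p S = int (card (cut S \<inter> A))" .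
    moreover have "net_out p S = int k"
      using S(1,2) \<open>y \<notin> S\<close>
      by (simp add: sum_net_out[symmetric] p(3) sum_distrib_left[symmetric] sum_subtractf of_bool_def)
    ultimately show False using cuts[OF S(1) \<open>y \<notin> S\<close>] by simp
  qed
  from S(5)[OF this] obtain q where
    "unit_path {e\<in>A. p e \<le> 0} {e\<in>A. p e \<ge> 0} S x y q" by blast
  note q = unit_pathD[OF this]
  have "p e + q e \<in> {-1, 0, 1} \<and> (p e + q e \<noteq> 0 \<longrightarrow> e \<in> A)" for e
    using p(1,2)[of e] q(1,3,4)[of e] by auto
  moreover have "net_out (\<lambda>e. p e + q e) {v} = int (Suc k) * (of_bool (v = x) - of_bool (v = y))" for v
    by (simp add: net_out_add p(3) q(5) algebra_simps)
  ultimately show ?thesis by (intro exI[of _ "\<lambda>e. p e + q e"]) simp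
qed

text \<open>Menger's theorem for two arc-disjoint undirected paths from \<open>x\<close> to \<open>y\<close>; their union is an
  even subgraph, and \<open>p\<close> sends one unit along each of them.\<close>

lemma two_disjoint_paths:
  assumes "A \<subseteq> E" and "\<And>S. x \<in> S \<Longrightarrow> y \<notin> S \<Longrightarrow> card (cut S \<inter> A) \<ge> 2"
  obtains p where "\<And>e. p e \<in> {-1, 0, 1}" "\<And>e. p e \<noteq> 0 \<Longrightarrow> e \<in> A"
    "\<And>v. net_out p {v} = 2 * (of_bool (v = x) - of_bool (v = y))"
proof -
  have c: "card (cut S \<inter> A) > 0" "card (cut S \<inter> A) > Suc 0" if "x \<in> S" "y \<notin> S" for S
    using assms(2)[OF that] by simp_all
  have "\<exists>p. (\<forall>e. p e \<in> {-1, 0, 1} \<and> (p e \<noteq> 0 \<longrightarrow> e \<in> A))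
      \<and> (\<forall>v. net_out p {v} = int (Suc 0) * (of_bool (v = x) - of_bool (v = y)))"
    by (rule augment[OF assms(1), of "\<lambda>e. 0"]) (simp_all add: c)
  then obtain p where p: "\<forall>e. p e \<in> {-1, 0, 1} \<and> (p e \<noteq> 0 \<longrightarrow> e \<in> A)"
    "\<forall>v. net_out p {v} = int (Suc 0) * (of_bool (v = x) - of_bool (v = y))"
    by blast
  have "\<exists>p. (\<forall>e. p e \<in> {-1, 0, 1} \<and> (p e \<noteq> 0 \<longrightarrow> e \<in> A))
      \<and> (\<forall>v. net_out p {v} = int (Suc (Suc 0)) * (of_bool (v = x) - of_bool (v = y)))"
    by (rule augment[OF assms(1), of p]) (use p c in blast)+
  then obtain p where p: "\<forall>e. p e \<in> {-1, 0, 1} \<and> (p e \<noteq> 0 \<longrightarrow> e \<in> A)"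
    "\<forall>v. net_out p {v} = int (Suc (Suc 0)) * (of_bool (v = x) - of_bool (v = y))"
    by blast
  show thesis by (rule that[of p]) (use p in auto)
qed

section \<open>Lifting flows modulo \<open>k\<close> to integer flows\<close>

text \<open>Tutte: a flow modulo \<open>k\<close> lifts to an integer flow with values of absolute value less than
  \<open>k\<close>. Among all such lifts one of least total imbalance is a flow, since an imbalance could be
  reduced by subtracting \<open>k\<close> along a path from a source to a sink of the lift.\<close>

lemma integer_flow_lift:
  fixes k :: int
  assumes "k > 0" and "\<And>v. k dvd net_out f {v}"
  obtains f' where "\<And>e. k dvd f e - f' e" "\<And>e. \<bar>f' e\<bar> < k" "\<And>v. net_out f' {v} = 0"
proof -
  define V where "V = src ` E \<union> tgt ` E"
  have "finite V" using finite_E by (simp add: V_def)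
  have outside: "net_out g {v} = 0" if "v \<notin> V" for g v
    using that by (intro net_out_eq_0) (auto simp: V_def cut_def)
  have total: "(\<Sum>v\<in>V. net_out g {v}) = 0" for g
    unfolding sum_net_out[OF \<open>finite V\<close>] by (rule net_out_eq_0) (auto simp: V_def cut_def)
  define P where "P g \<longleftrightarrow> (\<forall>e. k dvd f e - g e \<and> \<bar>g e\<bar> < k)" for g
  define imb where "imb g = nat (\<Sum>v\<in>V. \<bar>net_out g {v}\<bar>)" for g
  have "P (\<lambda>e. f e mod k)"
    using assms(1) by (simp add: P_def minus_mod_eq_mult_div)
  then obtain g where g: "P g" and least: "\<And>g'. P g' \<Longrightarrow> imb g \<le> imb g'"
    using ex_has_least_nat[of P _ imb] by blast
  have dvd: "k dvd net_out g {v}" for v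
  proof -
    have "k dvd net_out (\<lambda>e. f e - g e) {v}"
      unfolding net_out_def using g by (intro dvd_sum) (auto simp: P_def)
    then show ?thesis
      using assms(2)[of v] by (simp add: net_out_diff dvd_diff_right_iff)
  qed
  have "net_out g {v} = 0" for v
  proof (rule ccontr)
    assume nz: "net_out g {v} \<noteq> 0"
    then have "v \<in> V" using outside by blast
    have "\<exists>x\<in>V. net_out g {x} > 0"
    proof (rule ccontr)
      assume "\<not> ?thesis"
      then have le: "\<And>x. x \<in> V \<Longrightarrow> - net_out g {x} \<ge> 0" by force
      have "(\<Sum>x\<in>V. - net_out g {x}) = 0" using total[of g] by (simp add: sum_negf)
      then show False
        using sum_nonneg_eq_0_iff[OF \<open>finite V\<close> le] \<open>v \<in> V\<close> nz by auto
    qed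
    then obtain x where x: "x \<in> V" "net_out g {x} > 0" by blast
    obtain S where S: "x \<in> S" "finite S"
      "S \<subseteq> insert x (src ` ({e\<in>E. g e > 0} \<union> {e\<in>E. g e < 0}) \<union> tgt ` ({e\<in>E. g e > 0} \<union> {e\<in>E. g e < 0}))"
      "\<And>e. e \<in> {e\<in>E. g e > 0} \<Longrightarrow> src e \<in> S \<Longrightarrow> tgt e \<in> S"
      "\<And>e. e \<in> {e\<in>E. g e < 0} \<Longrightarrow> tgt e \<in> S \<Longrightarrow> src e \<in> S"
      "\<And>z. z \<in> S \<Longrightarrow> \<exists>q. unit_path {e\<in>E. g e > 0} {e\<in>E. g e < 0} S x z q"
      by (rule reachable_set[of "{e\<in>E. g e > 0}" "{e\<in>E. g e < 0}" x]) blast+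
    \<comment> \<open>\<open>S\<close> is closed under following the flow \<open>g\<close>, so
      \<open>g\<close> crosses its boundary only inwards. Since the source \<open>x\<close> lies in
      \<open>S\<close>, a sink must lie there too.\<close>
    have "net_out g S \<le> 0"
      unfolding net_out_def
    proof (rule sum_nonpos)
      fix e assume "e \<in> E"
      then have "g e > 0 \<Longrightarrow> src e \<in> S \<longrightarrow> tgt e \<in> S" "g e < 0 \<Longrightarrow> tgt e \<in> S \<longrightarrow> src e \<in> S"
        using S(4,5)[of e] by simp_all
      then show "g e * (of_bool (src e \<in> S) - of_bool (tgt e \<in> S)) \<le> 0"
        by (cases "g e" "0 :: int" rule: linorder_cases) (simp_all add: of_bool_def)
    qed
    have "\<exists>z\<in>S. net_out g {z} < 0"
    proof (rule ccontr)
      assume "\<not> ?thesis"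
      then have "\<And>z. z \<in> S \<Longrightarrow> net_out g {z} \<ge> 0" by force
      then have "net_out g {x} \<le> (\<Sum>z\<in>S. net_out g {z})"
        using S(1,2) by (intro member_le_sum) auto
      with x(2) \<open>net_out g S \<le> 0\<close> show False using sum_net_out[OF S(2)] by simp
    qed
    then obtain z where z: "z \<in> S" "net_out g {z} < 0" by blast
    then have "z \<in> V" using outside by force
    from S(6)[OF z(1)] obtain q where
      "unit_path {e\<in>E. g e > 0} {e\<in>E. g e < 0} S x z q" by blast
    note q = unit_pathD[OF this]
    \<comment> \<open>The path follows the direction of the flow, so a value in
      \<open>{1..k-1}\<close> can only drop by \<open>k\<close> and a value in
      \<open>{-(k-1)..-1}\<close> can only rise by \<open>k\<close>; both stay within the
      bound.\<close>
    define g' where "g' = (\<lambda>e. g e - k * q e)"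
    have "k dvd f e - g' e \<and> \<bar>g' e\<bar> < k" for e
    proof -
      have "f e - g' e = (f e - g e) + k * q e" by (simp add: g'_def)
      then have "k dvd f e - g' e" using g by (simp only: P_def dvd_add dvd_triv_left)
      moreover have "\<bar>g e\<bar> < k" using g by (simp add: P_def)
      ultimately show ?thesis using q(1,3,4)[of e] assms(1) by (auto simp: g'_def)
    qed
    then have "P g'" by (simp add: P_def)
    have net': "net_out g' {v} = net_out g {v} - k * of_bool (v = x) + k * of_bool (v = z)" for v
      by (simp add: g'_def net_out_diff net_out_scale q(5) algebra_simps)
    have "x \<noteq> z" using x z by auto
    \<comment> \<open>Imbalances are multiples of \<open>k\<close>, so the correction by
      \<open>k\<close> does not overshoot zero at \<open>x\<close> or at \<open>z\<close>.\<close>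
    have gx: "net_out g {x} \<ge> k" using dvd x(2) by (simp add: zdvd_imp_le)
    have gz: "- net_out g {z} \<ge> k" using dvd[of z] z(2) by (intro zdvd_imp_le) auto
    have "(\<Sum>v\<in>V. \<bar>net_out g' {v}\<bar>) < (\<Sum>v\<in>V. \<bar>net_out g {v}\<bar>)"
    proof (rule sum_strict_mono_ex1[OF \<open>finite V\<close>])
      show "\<forall>v\<in>V. \<bar>net_out g' {v}\<bar> \<le> \<bar>net_out g {v}\<bar>"
        using gx gz \<open>x \<noteq> z\<close> assms(1) by (auto simp: net')
      show "\<exists>v\<in>V. \<bar>net_out g' {v}\<bar> < \<bar>net_out g {v}\<bar>"
        using gx \<open>x \<noteq> z\<close> assms(1) x(1) by (intro bexI[of _ x]) (auto simp: net')
    qed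
    then have "imb g' < imb g" unfolding imb_def
      by (subst nat_less_eq_zless) (simp_all add: sum_nonneg)
    with least[OF \<open>P g'\<close>] show False by simp
  qed
  then show thesis using that[of g] g by (simp add: P_def)
qed

end

section \<open>Growing a closed vertex set\<close>

text \<open>Since \<open>b * b = 1\<close>, each \<open>x\<close> determines
  \<open>y = b * (c - a * x)\<close>. The candidates \<open>r + 1\<close> and \<open>r + 2\<close>
  for \<open>x\<close> both avoid \<open>r\<close> modulo 3, and their values of \<open>y\<close>
  differ by 1 in absolute value, so at most one of these is congruent to \<open>s\<close>.\<close>

lemma avoid_residues:
  fixes a b c r s :: int
  assumes "a = 1 \<or> a = -1" "b = 1 \<or> b = -1"
  obtains x y where "a * x + b * y = c" "\<not> 3 dvd x - r" "\<not> 3 dvd y - s"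
proof -
  have y: "a * x + b * (b * (c - a * x)) = c" for x
    using assms by auto
  have "\<not> 3 dvd b * (c - a * (r + 1)) - s \<or> \<not> 3 dvd b * (c - a * (r + 2)) - s"
    using assms by (elim disjE) (simp, presburger)+
  then show thesis
    using that[OF y, of "r + 1"] that[OF y, of "r + 2"] by auto
qed

context finite_arcs
begin

text \<open>Seymour's 2-closure, in the form of group connectivity: modulo the odd support of \<open>f\<close>, on
  which no constraint is put, the subgraph induced on \<open>U\<close> admits all boundaries \<open>b\<close> while avoiding
  all prescribed residues \<open>w\<close> modulo 3.\<close>

definition closed_up_to :: "('e \<Rightarrow> int) \<Rightarrow> 'v set \<Rightarrow> bool" where
  "closed_up_to f U \<longleftrightarrow> (\<forall>v. even (net_out f {v})) \<and> (\<forall>e. f e \<noteq> 0 \<longrightarrow> e \<in> inner U) \<and>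
     (\<forall>b w. (\<Sum>v\<in>U. b v) = 0 \<longrightarrow>
       (\<exists>g. (\<forall>e. g e \<noteq> 0 \<longrightarrow> e \<in> inner U) \<and> (\<forall>v\<in>U. net_out g {v} = b v) \<and>
         (\<forall>e\<in>inner U. odd (f e) \<or> \<not> 3 dvd (g e - w e))))"

lemma net_out_supported:
  assumes "\<And>e. g e \<noteq> 0 \<Longrightarrow> e \<in> inner X" and "X \<subseteq> Y \<or> X \<inter> Y = {}"
  shows "net_out g Y = 0"
  using assms by (intro net_out_eq_0) (force simp: cut_def inner_def)

text \<open>By \<open>solve\<close>, the arcs on which \<open>p\<close> is odd can realize every
  boundary on \<open>W\<close> of sum zero, and they carry no constraint. It remains to fix values
  on the other new arcs so that the demand left on \<open>W\<close>, and hence that on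
  \<open>U\<close>, has sum zero; the two arcs \<open>e1\<close> and \<open>e2\<close> have just
  enough freedom for this.\<close>

lemma closed_up_to_merge:
  assumes U: "closed_up_to f U" "finite U" and W: "finite W" "U \<inter> W = {}"
    and p: "\<And>v. even (net_out p {v})" "\<And>e. p e \<noteq> 0 \<Longrightarrow> e \<in> inner W"
    and solve: "\<And>b. (\<Sum>v\<in>W. b v) = 0 \<Longrightarrow>
      \<exists>g. (\<forall>e. g e \<noteq> 0 \<longrightarrow> e \<in> inner W \<and> odd (p e)) \<and> (\<forall>v\<in>W. net_out g {v} = b v)"
    and e: "e1 \<in> between W U" "e2 \<in> between W U" "e1 \<noteq> e2"
  shows "closed_up_to (\<lambda>e. f e + p e) (U \<union> W)"
  unfolding closed_up_to_def
proof (intro conjI allI impI)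
  have f: "\<And>v. even (net_out f {v})" "\<And>e. f e \<noteq> 0 \<Longrightarrow> e \<in> inner U"
    using U(1) unfolding closed_up_to_def by blast+
  show "even (net_out (\<lambda>e. f e + p e) {v})" for v
    using f(1) p(1) by (simp add: net_out_add)
  show "e \<in> inner (U \<union> W)" if "f e + p e \<noteq> 0" for e
    using f(2)[of e] p(2)[of e] that by (cases "f e = 0") (auto simp: inner_def)
  fix b :: "'v \<Rightarrow> int" and w :: "'e \<Rightarrow> int"
  assume "(\<Sum>v\<in>U \<union> W. b v) = 0"
  then have b: "(\<Sum>v\<in>U. b v) = - (\<Sum>v\<in>W. b v)"
    using U(2) W by (simp add: sum.union_disjoint)
  \<comment> \<open>The new constrained arcs: those between \<open>U\<close> and \<open>W\<close>,
    and those inside \<open>W\<close> on which \<open>p\<close> is even.\<close>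
  define N where "N = inner (U \<union> W) - inner U - {e \<in> inner W. odd (p e)}"
  have N: "e1 \<in> N" "e2 \<in> N" "N \<subseteq> E"
    using e W(2) by (auto simp: N_def between_def inner_def)
  define g0 where "g0 = (\<lambda>e. if e \<in> N - {e1, e2} then w e + 1 else 0)"
  define \<sigma> where "\<sigma> e = (of_bool (src e \<in> W) - of_bool (tgt e \<in> W) :: int)" for e
  have "\<sigma> e1 = 1 \<or> \<sigma> e1 = -1" "\<sigma> e2 = 1 \<or> \<sigma> e2 = -1"
    using e W(2) by (auto simp: \<sigma>_def between_def)
  \<comment> \<open>The flow across the cut between \<open>W\<close> and \<open>U\<close> has to
    equal the total demand of \<open>W\<close>.\<close>
  from avoid_residues[OF this, of "(\<Sum>v\<in>W. b v) - net_out g0 W" "w e1" "w e2"]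
  obtain x y where xy: "\<sigma> e1 * x + \<sigma> e2 * y = (\<Sum>v\<in>W. b v) - net_out g0 W"
    "\<not> 3 dvd x - w e1" "\<not> 3 dvd y - w e2" .
  define g1 where "g1 = (\<lambda>e. g0 e + ((if e = e1 then x else 0) + (if e = e2 then y else 0)))"
  have g1W: "net_out g1 W = (\<Sum>v\<in>W. b v)"
    using xy(1) N unfolding g1_def net_out_add
    by (subst (1 2) net_out_single) (auto simp: \<sigma>_def mult.commute)
  have g1_supp: "g1 e \<noteq> 0 \<Longrightarrow> e \<in> N" for e
    using N by (auto simp: g1_def g0_def split: if_splits)
  have g1_avoid: "\<not> 3 dvd g1 e - w e" if "e \<in> N" for e
    using that xy(2,3) e(3) by (auto simp: g1_def g0_def)
  have "g1 e \<noteq> 0 \<Longrightarrow> e \<in> inner (U \<union> W)" for e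
    using g1_supp[of e] by (auto simp: N_def)
  \<comment> \<open>What \<open>g1\<close> sends out of \<open>W\<close> enters \<open>U\<close>,
    and the demands of \<open>U\<close> and \<open>W\<close> are opposite, so \<open>U\<close> is
    balanced as well.\<close>
  then have "net_out g1 (U \<union> W) = 0"
    by (rule net_out_supported) auto
  then have g1U: "net_out g1 U = (\<Sum>v\<in>U. b v)"
    using net_out_Un[OF W(2), of g1] g1W b by simp
  have "(\<Sum>v\<in>W. b v - net_out g1 {v}) = 0"
    by (simp add: sum_subtractf sum_net_out W(1) g1W)
  from solve[OF this] obtain g2 where g2: "\<And>e. g2 e \<noteq> 0 \<Longrightarrow> e \<in> inner W \<and> odd (p e)"
    "\<And>v. v \<in> W \<Longrightarrow> net_out g2 {v} = b v - net_out g1 {v}" by auto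
  have "(\<Sum>v\<in>U. b v - net_out g1 {v}) = 0"
    by (simp add: sum_subtractf sum_net_out U(2) g1U)
  with U(1) have "\<exists>g. (\<forall>e. g e \<noteq> 0 \<longrightarrow> e \<in> inner U) \<and> (\<forall>v\<in>U. net_out g {v} = b v - net_out g1 {v}) \<and>
         (\<forall>e\<in>inner U. odd (f e) \<or> \<not> 3 dvd (g e - w e))"
    unfolding closed_up_to_def by blast
  then obtain g3 where g3: "\<And>e. g3 e \<noteq> 0 \<Longrightarrow> e \<in> inner U"
    "\<And>v. v \<in> U \<Longrightarrow> net_out g3 {v} = b v - net_out g1 {v}"
    "\<And>e. e \<in> inner U \<Longrightarrow> odd (f e) \<or> \<not> 3 dvd (g3 e - w e)"
    by blast
  have disj: "inner U \<inter> inner W = {}" using W(2) by (auto simp: inner_def)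
  show "\<exists>g. (\<forall>e. g e \<noteq> 0 \<longrightarrow> e \<in> inner (U \<union> W)) \<and> (\<forall>v\<in>U \<union> W. net_out g {v} = b v) \<and>
         (\<forall>e\<in>inner (U \<union> W). odd (f e + p e) \<or> \<not> 3 dvd (g e - w e))"
  proof (intro exI[of _ "\<lambda>e. g1 e + (g2 e + g3 e)"] conjI allI impI ballI)
    fix e assume "g1 e + (g2 e + g3 e) \<noteq> 0"
    then have "g1 e \<noteq> 0 \<or> g2 e \<noteq> 0 \<or> g3 e \<noteq> 0" by auto
    then show "e \<in> inner (U \<union> W)"
      using g1_supp[of e] g2(1)[of e] g3(1)[of e] by (auto simp: N_def inner_def)
  next
    fix v assume v: "v \<in> U \<union> W"
    have "net_out g2 {v} = 0" if "v \<in> U"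
      using that W(2) g2(1) by (intro net_out_supported[of g2 W]) auto
    moreover have "net_out g3 {v} = 0" if "v \<in> W"
      using that W(2) g3(1) by (intro net_out_supported[of g3 U]) auto
    ultimately show "net_out (\<lambda>e. g1 e + (g2 e + g3 e)) {v} = b v"
      using v g2(2)[of v] g3(2)[of v] by (auto simp: net_out_add)
  next
    fix e assume e: "e \<in> inner (U \<union> W)"
    consider "e \<in> inner U" | "e \<in> inner W" "odd (p e)" | "e \<in> N"
      using e by (auto simp: N_def)
    then show "odd (f e + p e) \<or> \<not> 3 dvd (g1 e + (g2 e + g3 e) - w e)"
    proof cases
      case 1
      then have "g1 e = 0" "g2 e = 0" "p e = 0"
        using g1_supp[of e] g2(1)[of e] p(2)[of e] disj by (auto simp: N_def)
      then show ?thesis using g3(3)[OF 1] by simp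
    next
      case 2
      then have "f e = 0" using f(2)[of e] disj by auto
      then show ?thesis using 2 by simp
    next
      case 3
      then have "g2 e = 0" "g3 e = 0" using g2(1)[of e] g3(1)[of e] by (auto simp: N_def)
      then show ?thesis using g1_avoid[OF 3] by simp
    qed
  qed
qed

lemma closed_up_to_singleton: "closed_up_to (\<lambda>e. 0) {v}"
  unfolding closed_up_to_def
proof (intro conjI allI impI)
  fix b :: "'v \<Rightarrow> int" and w :: "'e \<Rightarrow> int"
  assume "(\<Sum>v\<in>{v}. b v) = 0"
  \<comment> \<open>\<open>inner {v}\<close> consists of the loops at \<open>v\<close>, whose values
    do not affect any boundary.\<close>
  define g where "g = (\<lambda>e. if e \<in> inner {v} then w e + 1 else 0)"
  have "net_out g {v} = 0"
    by (rule net_out_supported[of g "{v}"]) (auto simp: g_def split: if_splits)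
  then show "\<exists>g. (\<forall>e. g e \<noteq> 0 \<longrightarrow> e \<in> inner {v}) \<and> (\<forall>v\<in>{v}. net_out g {v} = b v) \<and>
       (\<forall>e\<in>inner {v}. odd (0 :: int) \<or> \<not> 3 dvd (g e - w e))"
    using \<open>(\<Sum>v\<in>{v}. b v) = 0\<close> by (intro exI[of _ g]) (auto simp: g_def)
qed auto

text \<open>\<open>W\<close> is the component of \<open>x\<close> in the support of
  \<open>p\<close>, and \<open>p'\<close> is \<open>p\<close> restricted to it. No arc of the
  support leaves \<open>W\<close>, so the outflow 2 at \<open>x\<close> must be absorbed at
  \<open>y\<close> inside \<open>W\<close>. All nonzero values of \<open>p\<close> are odd, and a
  connected subgraph realizes every boundary of sum zero.\<close>

lemma path_component:
  assumes p: "\<And>e. p e \<in> {-1, 0, 1}" "\<And>e. p e \<noteq> 0 \<Longrightarrow> e \<in> inner B"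
      "\<And>v. net_out p {v} = 2 * (of_bool (v = x) - of_bool (v = y))" and "x \<in> B"
  obtains W p' where "x \<in> W" "y \<in> W" "W \<subseteq> B" "finite W"
    "\<And>v. even (net_out p' {v})" "\<And>e. p' e \<noteq> 0 \<Longrightarrow> e \<in> inner W"
    "\<And>b. (\<Sum>v\<in>W. b v) = 0 \<Longrightarrow>
      \<exists>g. (\<forall>e. g e \<noteq> 0 \<longrightarrow> e \<in> inner W \<and> odd (p' e)) \<and> (\<forall>v\<in>W. net_out g {v} = b v)"
proof -
  define F where "F = {e\<in>E. p e \<noteq> 0}"
  obtain W where W: "x \<in> W" "W \<subseteq> insert x (src ` (F \<union> F) \<union> tgt ` (F \<union> F))" "finite W"
    "\<And>e. e \<in> F \<Longrightarrow> src e \<in> W \<Longrightarrow> tgt e \<in> W" "\<And>e. e \<in> F \<Longrightarrow> tgt e \<in> W \<Longrightarrow> src e \<in> W"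
    "\<And>z. z \<in> W \<Longrightarrow> \<exists>q. unit_path F F W x z q"
    by (rule reachable_set[of F F x]) (auto simp: F_def)
  have "net_out p W = 0"
    using W(4,5) by (intro net_out_eq_0) (auto simp: cut_def F_def)
  then have "(\<Sum>v\<in>W. 2 * (of_bool (v = x) - of_bool (v = y)) :: int) = 0"
    using sum_net_out[OF W(3), of p] by (simp add: p(3))
  then have "y \<in> W"
    using W(1,3) by (auto simp: sum_distrib_left[symmetric] sum_subtractf of_bool_def split: if_splits)
  define p' where "p' = (\<lambda>e. if e \<in> inner W then p e else 0)"
  have p'_odd: "odd (p' e)" if "e \<in> inner W" "e \<in> F" for e
    using that p(1)[of e] by (auto simp: p'_def F_def)
  have even: "even (net_out p' {v})" for v
  proof (cases "v \<in> W")
    case True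
    have "net_out p' {v} = net_out p {v}"
    proof (rule net_out_cong)
      fix e assume "e \<in> cut {v}"
      then show "p' e = p e"
        using W(4,5)[of e] True by (cases "p e = 0") (auto simp: p'_def cut_def inner_def F_def)
    qed
    then show ?thesis using p(3) by simp
  next
    case False
    then have "net_out p' {v} = 0"
      by (intro net_out_supported[of p' W]) (auto simp: p'_def split: if_splits)
    then show ?thesis by simp
  qed
  have solve: "\<exists>g. (\<forall>e. g e \<noteq> 0 \<longrightarrow> e \<in> inner W \<and> odd (p' e)) \<and> (\<forall>v\<in>W. net_out g {v} = b v)"
    if b: "(\<Sum>v\<in>W. b v) = 0" for b
  proof -
    obtain q where q: "\<And>z. z \<in> W \<Longrightarrow> unit_path F F W x z (q z)"
      using W(6) by metis
    \<comment> \<open>Each demand is routed separately along a path from the root \<open>x\<close>.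
      At \<open>x\<close> itself the routed amounts add up correctly because \<open>b\<close> has
      sum zero.\<close>
    define g where "g = (\<lambda>e. \<Sum>z\<in>W. (- b z) * q z e)"
    have "e \<in> inner W \<and> odd (p' e)" if nz: "g e \<noteq> 0" for e
    proof -
      obtain z where "z \<in> W" "- b z * q z e \<noteq> 0"
        using sum.not_neutral_contains_not_neutral nz unfolding g_def by blast
      then have "e \<in> inner W" "e \<in> F" using unit_pathD(1-4)[OF q[OF \<open>z \<in> W\<close>], of e] by auto
      then show ?thesis using p'_odd by blast
    qed
    moreover have "net_out g {v} = b v" if "v \<in> W" for v
    proof -
      have "net_out g {v} = (\<Sum>z\<in>W. (- b z) * (of_bool (v = x) - of_bool (v = z)))"
        unfolding g_def net_out_sum net_out_scale
        by (intro sum.cong refl) (simp add: unit_pathD(5)[OF q])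
      also have "\<dots> = (\<Sum>z\<in>W. (if v = z then b z else 0) - of_bool (v = x) * b z)"
        by (intro sum.cong) auto
      also have "\<dots> = (\<Sum>z\<in>W. if v = z then b z else 0) - of_bool (v = x) * (\<Sum>z\<in>W. b z)"
        by (simp add: sum_distrib_left sum_subtractf)
      finally show ?thesis using b that W(3) by simp
    qed
    ultimately show ?thesis by blast
  qed
  show thesis
  proof (rule that[of W p'])
    show "W \<subseteq> B" using W(2) p(2) \<open>x \<in> B\<close> by (auto simp: F_def inner_def)
    show "e \<in> inner W" if "p' e \<noteq> 0" for e using that by (auto simp: p'_def split: if_splits)
  qed (use W \<open>y \<in> W\<close> even solve in auto)
qed

text \<open>The block argument: a minimal \<open>B\<close> outside \<open>U\<close> that sends at most one arc to the rest of the
  complement of \<open>U\<close> is 2-edge-connected between the ends of its (at least two) arcs to \<open>U\<close>.\<close>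

lemma closed_up_to_extend:
  assumes "closed_up_to f U" and "cut U \<noteq> {}"
    and V: "finite V" "src ` E \<union> tgt ` E \<subseteq> V" "U \<subseteq> V"
    and cuts: "\<And>X. cut X \<noteq> {} \<Longrightarrow> card (cut X) \<ge> 3"
  obtains f' U' where "closed_up_to f' U'" "U \<subset> U'" "U' \<subseteq> V"
proof -
  have "finite U" using V finite_subset by blast
  \<comment> \<open>The condition \<open>cut B \<noteq> {}\<close> excludes the empty set and makes
    the lower bound 3 on cuts applicable to \<open>B\<close>.\<close>
  define P where "P B \<longleftrightarrow> B \<subseteq> V - U \<and> card (between B (V - U - B)) \<le> 1 \<and> cut B \<noteq> {}" for B
  have "P (V - U)"
  proof -
    have "between (V - U) (V - U - (V - U)) = {}" by (auto simp: between_def)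
    moreover have "cut (V - U) = cut U" using V(2) by (auto simp: cut_def)
    ultimately show ?thesis using assms(2) by (simp add: P_def)
  qed
  then obtain B where B: "P B" and min: "\<And>B'. P B' \<Longrightarrow> card B \<le> card B'"
    using ex_has_least_nat[of P _ card] by blast
  have "finite B" using B V(1) by (auto simp: P_def intro: finite_subset)
  have "cut B = between B (V - U - B) \<union> between B U"
    using B V(2,3) by (auto simp: P_def cut_def between_def)
  then have "card (cut B) \<le> card (between B (V - U - B)) + card (between B U)"
    by (simp add: card_Un_le)
  \<comment> \<open>Of the at least three arcs leaving \<open>B\<close>, at most one goes to the
    rest of the complement.\<close>
  then have "card (between B U) > Suc 0"
    using B cuts[of B] by (auto simp: P_def)
  then obtain e1 e2 where e: "e1 \<in> between B U" "e2 \<in> between B U" "e1 \<noteq> e2"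
    by (metis card_le_Suc0_iff_eq finite_between not_less)
  obtain x where x: "x \<in> B" "e1 \<in> between {x} U" using e(1) by (auto simp: between_def)
  obtain y where y: "y \<in> B" "e2 \<in> between {y} U" using e(2) by (auto simp: between_def)
  have "\<exists>W p. x \<in> W \<and> y \<in> W \<and> W \<subseteq> B \<and> finite W \<and>
    (\<forall>v. even (net_out p {v})) \<and> (\<forall>e. p e \<noteq> 0 \<longrightarrow> e \<in> inner W) \<and>
    (\<forall>b. (\<Sum>v\<in>W. b v) = 0 \<longrightarrow>
      (\<exists>g. (\<forall>e. g e \<noteq> 0 \<longrightarrow> e \<in> inner W \<and> odd (p e)) \<and> (\<forall>v\<in>W. net_out g {v} = b v)))"
  proof (cases "x = y")
    case True
    have "\<exists>g. (\<forall>e. g e \<noteq> 0 \<longrightarrow> e \<in> inner {x} \<and> odd (0 :: int)) \<and> (\<forall>v\<in>{x}. net_out g {v} = b v)"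
      if "(\<Sum>v\<in>{x}. b v) = 0" for b
      using that by (intro exI[of _ "\<lambda>e. 0"]) simp
    then show ?thesis
      using True x(1) by (intro exI[of _ "{x}"] exI[of _ "\<lambda>e. 0"]) simp
  next
    case False
    \<comment> \<open>If at most one arc of \<open>inner B\<close> crossed \<open>S\<close>, then
      \<open>B\<close> would split into \<open>L\<close> and \<open>R\<close> joined by at most one
      arc. At most one arc joins \<open>B\<close> to \<open>O'\<close>, so one of the two parts has
      no arc to \<open>O'\<close>. That part satisfies \<open>P\<close>, with \<open>e1\<close> or
      \<open>e2\<close> in its cut, against the minimality of \<open>B\<close>.\<close>
    have two: "card (cut S \<inter> inner B) \<ge> 2" if S: "x \<in> S" "y \<notin> S" for S
    proof (rule ccontr)
      assume less: "\<not> ?thesis"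
      define L R where "L = S \<inter> B" and "R = B - S"
      have le: "card (between L R) \<le> 1"
      proof -
        have "between L R = cut S \<inter> inner B"
          by (auto simp: L_def R_def between_def cut_def inner_def)
        then show ?thesis using less by simp
      qed
      define O' where "O' = V - U - B"
      have "between B O' = between L O' \<union> between R O'"
        by (auto simp: L_def R_def between_def O'_def)
      moreover have "between L O' \<inter> between R O' = {}"
        by (auto simp: L_def R_def between_def O'_def)
      ultimately have "card (between L O') + card (between R O') \<le> 1"
        using B by (simp add: P_def O'_def card_Un_disjoint[symmetric])
      then have "card (between L O') = 0 \<or> card (between R O') = 0"
        by linarith
      then have "between L O' = {} \<or> between R O' = {}"
        by simp
      then have "\<exists>B'. B' \<subset> B \<and> P B'"
      proof
        assume 0: "between L O' = {}"
        have "between L (V - U - L) = between L R \<union> between L O'"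
          using B by (auto simp: L_def R_def between_def O'_def P_def)
        moreover have "e1 \<in> cut L"
          using x S B by (auto simp: L_def between_def cut_def P_def)
        ultimately have "P L" using 0 le B by (auto simp: P_def L_def)
        moreover have "L \<subset> B" using S y(1) by (auto simp: L_def)
        ultimately show ?thesis by blast
      next
        assume 0: "between R O' = {}"
        have "between R (V - U - R) = between L R \<union> between R O'"
          using B by (auto simp: L_def R_def between_def O'_def P_def)
        moreover have "e2 \<in> cut R"
          using y S B by (auto simp: R_def between_def cut_def P_def)
        ultimately have "P R" using 0 le B by (auto simp: P_def R_def)
        moreover have "R \<subset> B" using S x(1) by (auto simp: R_def)
        ultimately show ?thesis by blast
      qed
      then show False using min \<open>finite B\<close> psubset_card_mono by (meson not_less)
    qed
    have "inner B \<subseteq> E" by (auto simp: inner_def)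
    from two_disjoint_paths[OF this two] obtain p where p:
      "\<And>e. p e \<in> {-1, 0, 1}" "\<And>e. p e \<noteq> 0 \<Longrightarrow> e \<in> inner B"
      "\<And>v. net_out p {v} = 2 * (of_bool (v = x) - of_bool (v = y))" by blast
    show ?thesis
      by (rule path_component[OF p x(1)]) blast+
  qed
  then obtain W p where W: "x \<in> W" "y \<in> W" "W \<subseteq> B" "finite W"
    "\<And>v. even (net_out p {v})" "\<And>e. p e \<noteq> 0 \<Longrightarrow> e \<in> inner W"
    "\<And>b. (\<Sum>v\<in>W. b v) = 0 \<Longrightarrow>
      \<exists>g. (\<forall>e. g e \<noteq> 0 \<longrightarrow> e \<in> inner W \<and> odd (p e)) \<and> (\<forall>v\<in>W. net_out g {v} = b v)"
    by blast
  have "U \<inter> W = {}" using W(3) B by (auto simp: P_def)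
  have "e1 \<in> between W U" "e2 \<in> between W U"
    using x(2) y(2) W(1,2) by (auto simp: between_def)
  from closed_up_to_merge[OF assms(1) \<open>finite U\<close> W(4) \<open>U \<inter> W = {}\<close> W(5,6,7) this e(3)]
  have "closed_up_to (\<lambda>e. f e + p e) (U \<union> W)" .
  then show thesis
    by (rule that) (use W(1,3) \<open>U \<inter> W = {}\<close> B V(3) in \<open>auto simp: P_def\<close>)
qed

text \<open>A maximal closed set containing \<open>src e0\<close>, which exists because the
  singleton is closed, can no longer be extended and therefore has an empty cut.\<close>

lemma ex_closed_component:
  assumes "e0 \<in> E" and cuts: "\<And>X. cut X \<noteq> {} \<Longrightarrow> card (cut X) \<ge> 3"
  obtains f U where "closed_up_to f U" "cut U = {}" "e0 \<in> inner U"
proof -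
  define V where "V = src ` E \<union> tgt ` E"
  have V: "finite V" "src ` E \<union> tgt ` E \<subseteq> V" using finite_E by (auto simp: V_def)
  define P where "P U \<longleftrightarrow> src e0 \<in> U \<and> U \<subseteq> V \<and> (\<exists>f. closed_up_to f U)" for U
  have "P {src e0}"
    using closed_up_to_singleton assms(1) by (auto simp: P_def V_def)
  moreover have "finite {U. P U}"
    by (rule finite_subset[of _ "Pow V"]) (auto simp: P_def V(1))
  ultimately obtain U where U: "P U" and max: "\<And>U'. P U' \<Longrightarrow> U \<subseteq> U' \<Longrightarrow> U = U'"
    using finite_has_maximal[of "{U. P U}"] by blast
  then obtain f where f: "closed_up_to f U" by (auto simp: P_def)
  have "cut U = {}"
  proof (rule ccontr)
    assume "cut U \<noteq> {}"
    then obtain f' U' where "closed_up_to f' U'" "U \<subset> U'" "U' \<subseteq> V"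
      using closed_up_to_extend[OF f _ V _ cuts] U by (auto simp: P_def)
    then show False using max[of U'] U by (auto simp: P_def)
  qed
  moreover have "e0 \<in> inner U"
    using U \<open>cut U = {}\<close> assms(1) by (auto simp: P_def cut_def inner_def)
  ultimately show thesis using f that by blast
qed

section \<open>Gluing flows and contracting an arc of a 2-arc cut\<close>

lemma net_out_cut: "net_out f X = (\<Sum>e\<in>cut X. f e * (of_bool (src e \<in> X) - of_bool (tgt e \<in> X)))"
  unfolding net_out_def using finite_E by (intro sum.mono_neutral_right) (auto simp: cut_def)

lemma dvd_net_out:
  assumes "\<And>v. m dvd net_out f {v}"
  shows "m dvd net_out f X"
proof -
  let ?V = "src ` E \<union> tgt ` E"
  \<comment> \<open>\<open>X\<close> may be infinite, so it is first restricted to the finitely many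
    ends of arcs.\<close>
  have "net_out f X = net_out f (X \<inter> ?V)"
    unfolding net_out_def by (intro sum.cong) auto
  also have "\<dots> = (\<Sum>v\<in>X \<inter> ?V. net_out f {v})"
    using finite_E by (intro sum_net_out[symmetric]) auto
  finally show ?thesis using assms by (simp add: dvd_sum)
qed

lemma net_out_split:
  assumes "A \<subseteq> E" "\<And>e. f e \<noteq> 0 \<Longrightarrow> e \<in> A"
  shows "net_out (\<lambda>e. if e \<in> A then f e else g e) X
    = net_out f X + finite_arcs.net_out (E - A) src tgt g X"
proof -
  interpret H: finite_arcs "E - A" src tgt by unfold_locales (simp add: finite_E)
  have "net_out f X = (\<Sum>e\<in>A. f e * (of_bool (src e \<in> X) - of_bool (tgt e \<in> X)))"
    unfolding net_out_def using assms finite_E by (intro sum.mono_neutral_right) auto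
  then show ?thesis
    using sum.subset_diff[OF assms(1) finite_E, of "\<lambda>e. (if e \<in> A then f e else g e) * (of_bool (src e \<in> X) - of_bool (tgt e \<in> X))"]
    by (simp add: net_out_def H.net_out_def)
qed

context
  fixes e1 :: 'e and \<pi> :: "'v \<Rightarrow> 'v"
  assumes e1: "e1 \<in> E" and \<pi>: "\<pi> (src e1) = \<pi> (tgt e1)"
begin

interpretation H: finite_arcs "E - {e1}" "\<pi> \<circ> src" "\<pi> \<circ> tgt"
  by unfold_locales (simp add: finite_E)

text \<open>Contraction is expressed by relabelling the ends through \<open>\<pi>\<close>. A
  preimage under \<open>\<pi>\<close> contains both ends of \<open>e1\<close> or neither, so
  \<open>e1\<close> does not cross it.\<close>

lemma cut_contract: "finite_arcs.cut (E - {e1}) (\<pi> \<circ> src) (\<pi> \<circ> tgt) X = cut (\<pi> -` X)"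
  using \<pi> by (auto simp: H.cut_def cut_def)

lemma net_out_contract:
  "finite_arcs.net_out (E - {e1}) (\<pi> \<circ> src) (\<pi> \<circ> tgt) f X = net_out f (\<pi> -` X)"
  using finite_E e1 \<pi> by (simp add: H.net_out_def net_out_def sum.remove)

end

text \<open>The value on \<open>e1\<close> is forced by balance at \<open>tgt e1\<close>; balance
  modulo \<open>m\<close> at \<open>src e1\<close> follows from that at the contracted vertex.
  Across the cut \<open>{e1, e2}\<close> the two values then agree up to sign modulo
  \<open>m\<close>, so \<open>e1\<close> vanishes exactly when \<open>e2\<close> does.\<close>

lemma extend_over_contracted:
  assumes X: "cut X = {e1, e2}" "e1 \<noteq> e2"
    and \<pi>: "\<pi> = (\<lambda>v. if v = tgt e1 then src e1 else v)"
    and f: "\<And>v. m dvd finite_arcs.net_out (E - {e1}) (\<pi> \<circ> src) (\<pi> \<circ> tgt) f {v}"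
  obtains f' where "\<And>e. e \<noteq> e1 \<Longrightarrow> f' e = f e" "\<And>v. m dvd net_out f' {v}"
    "m dvd f' e1 \<longleftrightarrow> m dvd f e2"
proof -
  have "e1 \<in> cut X" using X(1) by simp
  then have e1: "e1 \<in> E" and loop: "src e1 \<noteq> tgt e1" by (auto simp: cut_def)
  have \<pi>1: "\<pi> (src e1) = \<pi> (tgt e1)" by (simp add: \<pi>)
  define f0 where "f0 = f(e1 := 0)"
  define f' where "f' = (\<lambda>e. f0 e + (if e = e1 then net_out f0 {tgt e1} else 0))"
  have f'_eq: "f' e = f e" if "e \<noteq> e1" for e using that by (simp add: f'_def f0_def)
  have "m dvd net_out f (\<pi> -` {v})" for v
    using f net_out_contract[OF e1 \<pi>1] by simp
  moreover have "net_out f (\<pi> -` {v}) = net_out f' (\<pi> -` {v})" for v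
    using \<pi>1 by (intro net_out_cong f'_eq[symmetric]) (auto simp: cut_def)
  ultimately have dvd: "m dvd net_out f' (\<pi> -` {v})" for v by simp
  have tgt: "net_out f' {tgt e1} = 0"
    using loop by (simp add: f'_def net_out_add net_out_single[OF e1])
  have all: "m dvd net_out f' {v}" for v
  proof (cases "v = src e1 \<or> v = tgt e1")
    case False
    then have "\<pi> -` {v} = {v}" by (auto simp: \<pi>)
    then show ?thesis using dvd[of v] by simp
  next
    case True
    have "\<pi> -` {src e1} = {src e1} \<union> {tgt e1}" by (auto simp: \<pi>)
    then have "m dvd net_out f' {src e1}"
      using dvd[of "src e1"] net_out_Un[of "{src e1}" "{tgt e1}" f'] loop tgt by simp
    then show ?thesis using True tgt by auto
  qed
  have "m dvd net_out f' X" using all by (rule dvd_net_out)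
  then have "m dvd f' e1 * (of_bool (src e1 \<in> X) - of_bool (tgt e1 \<in> X))
      + f' e2 * (of_bool (src e2 \<in> X) - of_bool (tgt e2 \<in> X))"
    using X by (simp add: net_out_cut)
  moreover have "(src e1 \<in> X) \<noteq> (tgt e1 \<in> X)" "(src e2 \<in> X) \<noteq> (tgt e2 \<in> X)"
    using X(1) by (auto simp: cut_def)
  ultimately have "m dvd f' e1 + f' e2 \<or> m dvd f' e1 - f' e2"
    by (cases "src e1 \<in> X"; cases "src e2 \<in> X") (auto simp: dvd_diff_commute add.commute minus_add_distrib[symmetric] simp del: minus_add_distrib)
  then have "m dvd f' e1 \<longleftrightarrow> m dvd f' e2"
    by (auto simp: dvd_add_right_iff dvd_add_left_iff dvd_diff_right_iff dvd_diff_left_iff)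
  then show thesis using that[OF f'_eq all] f'_eq[of e2] X(2) by auto
qed

end

section \<open>Seymour's theorem as a pair of flows modulo 2 and modulo 3\<close>

text \<open>Induction on the number of arcs. If there is a cut of two arcs, one of them is
  contracted and inherits its nonvanishing from the other. Otherwise all nonempty cuts have at least
  three arcs, and a closed set with empty cut is split off.\<close>

theorem six_flow:
  assumes "finite E" and "\<And>X. card (finite_arcs.cut E src tgt X) \<noteq> 1"
  shows "\<exists>f g. (\<forall>v. 2 dvd finite_arcs.net_out E src tgt f {v}) \<and>
    (\<forall>v. 3 dvd finite_arcs.net_out E src tgt g {v}) \<and>
    (\<forall>e\<in>E. \<not> 2 dvd f e \<or> \<not> 3 dvd g e)"
  using assms
proof (induction "card E" arbitrary: E src tgt rule: less_induct)
  case less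
  interpret finite_arcs E src tgt by unfold_locales (rule less.prems)
  show ?case
  proof (cases "\<exists>X. card (cut X) = 2")
    case True
    then obtain X e1 e2 where X: "cut X = {e1, e2}" "e1 \<noteq> e2" by (auto simp: card_2_iff)
    then have e: "e1 \<in> E" "e2 \<in> E" by (auto simp: cut_def)
    define \<pi> where "\<pi> = (\<lambda>v. if v = tgt e1 then src e1 else v)"
    have \<pi>: "\<pi> (src e1) = \<pi> (tgt e1)" by (simp add: \<pi>_def)
    interpret H: finite_arcs "E - {e1}" "\<pi> \<circ> src" "\<pi> \<circ> tgt"
      by unfold_locales (simp add: finite_E)
    have "card (E - {e1}) < card E" using e finite_E by (intro psubset_card_mono) auto
    moreover have "card (H.cut Y) \<noteq> 1" for Y
      unfolding cut_contract[OF e(1) \<pi>] by (rule less.prems)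
    ultimately obtain f g where fg: "\<And>v. 2 dvd H.net_out f {v}" "\<And>v. 3 dvd H.net_out g {v}"
      "\<And>e. e \<in> E - {e1} \<Longrightarrow> \<not> 2 dvd f e \<or> \<not> 3 dvd g e"
      using less.hyps[OF _ H.finite_E] by blast
    obtain f' where f': "\<And>e. e \<noteq> e1 \<Longrightarrow> f' e = f e" "\<And>v. 2 dvd net_out f' {v}"
      "2 dvd f' e1 \<longleftrightarrow> 2 dvd f e2"
      using extend_over_contracted[OF X \<pi>_def fg(1)] by blast
    obtain g' where g': "\<And>e. e \<noteq> e1 \<Longrightarrow> g' e = g e" "\<And>v. 3 dvd net_out g' {v}"
      "3 dvd g' e1 \<longleftrightarrow> 3 dvd g e2"
      using extend_over_contracted[OF X \<pi>_def fg(2)] by blast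
    have "\<not> 2 dvd f' e \<or> \<not> 3 dvd g' e" if "e \<in> E" for e
      using that fg(3)[of e] fg(3)[of e2] e(2) X(2) f'(1,3) g'(1,3) by (cases "e = e1") auto
    then show ?thesis using f'(2) g'(2) by blast
  next
    case False
    have cuts: "card (cut X) \<ge> 3" if "cut X \<noteq> {}" for X
    proof -
      have "card (cut X) \<noteq> 0" "card (cut X) \<noteq> 1" "card (cut X) \<noteq> 2"
        using that False less.prems(2) by auto
      then show ?thesis by linarith
    qed
    show ?thesis
    proof (cases "E = {}")
      case True
      then have "\<forall>e\<in>E. \<not> 2 dvd (0 :: int) \<or> \<not> 3 dvd (0 :: int)" by simp
      moreover have "2 dvd net_out (\<lambda>e. 0) {v}" "3 dvd net_out (\<lambda>e. 0) {v}" for v by simp_all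
      ultimately show ?thesis by (intro exI[of _ "\<lambda>e. 0"]) blast
    next
      case False
      then obtain e0 where "e0 \<in> E" by blast
      then obtain f U where U: "closed_up_to f U" "cut U = {}" "e0 \<in> inner U"
        using ex_closed_component cuts by blast
      have f: "even (net_out f {v})" "f e \<noteq> 0 \<Longrightarrow> e \<in> inner U" for v e
        using U(1) unfolding closed_up_to_def by blast+
      \<comment> \<open>Zero boundary and zero forbidden residues: closedness gives a flow that is
        nonzero modulo 3 wherever \<open>f\<close> is even on \<open>inner U\<close>.\<close>
      have "\<exists>g. (\<forall>e. g e \<noteq> 0 \<longrightarrow> e \<in> inner U) \<and> (\<forall>v\<in>U. net_out g {v} = 0) \<and>
         (\<forall>e\<in>inner U. odd (f e) \<or> \<not> 3 dvd (g e - 0))"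
        using U(1)[unfolded closed_up_to_def, THEN conjunct2, THEN conjunct2, rule_format,
            of "\<lambda>v. 0" "\<lambda>e. 0"] by simp
      then obtain g where g: "\<And>e. g e \<noteq> 0 \<Longrightarrow> e \<in> inner U" "\<And>v. v \<in> U \<Longrightarrow> net_out g {v} = 0"
        "\<And>e. e \<in> inner U \<Longrightarrow> odd (f e) \<or> \<not> 3 dvd g e" by auto
      have g0: "net_out g {v} = 0" for v
        using g(2) net_out_supported[of g U "{v}"] g(1) by (cases "v \<in> U") auto
      interpret H: finite_arcs "E - inner U" src tgt
        by unfold_locales (simp add: finite_E)
      have sub: "inner U \<subseteq> E" by (auto simp: inner_def)
      have "card (E - inner U) < card E"
        using finite_E U(3) sub by (intro psubset_card_mono) auto
      \<comment> \<open>No arc leaves \<open>U\<close>, so removing \<open>inner U\<close> removes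
        all arcs that touch \<open>U\<close>, and no cut of size 1 arises.\<close>
      moreover have "H.cut X = cut (X - U)" for X
        using U(2) unfolding H.cut_def by (auto simp: cut_def inner_def)
      then have "card (H.cut X) \<noteq> 1" for X
        using less.prems(2) by simp
      ultimately obtain f' g' where fg: "\<And>v. 2 dvd H.net_out f' {v}" "\<And>v. 3 dvd H.net_out g' {v}"
        "\<And>e. e \<in> E - inner U \<Longrightarrow> \<not> 2 dvd f' e \<or> \<not> 3 dvd g' e"
        using less.hyps[OF _ H.finite_E] by blast
      show ?thesis
      proof (intro exI conjI allI ballI)
        show "2 dvd net_out (\<lambda>e. if e \<in> inner U then f e else f' e) {v}" for v
          using net_out_split[OF sub f(2), where g = f' and X = "{v}"] f(1) fg(1) by simp
        show "3 dvd net_out (\<lambda>e. if e \<in> inner U then g e else g' e) {v}" for v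
          using net_out_split[OF sub g(1), where g = g' and X = "{v}"] g0 fg(2) by simp
      qed (use g(3) fg(3) in auto)
    qed
  qed
qed

section \<open>From bridgeless multigraphs to a plane flow\<close>

text \<open>If \<open>e\<close> were the only arc across \<open>X\<close>, then membership in
  \<open>X\<close> would be invariant along all walks avoiding \<open>e\<close>. Such a walk joins
  the ends of \<open>e\<close>, since \<open>e\<close> is not a bridge.\<close>

lemma card_cut_bridgeless:
  assumes G: "finite_multigraph G" "bridgeless G"
    and ends: "\<And>e. e \<in> edges G \<Longrightarrow> ends G e = {src e, tgt e}"
  shows "card (finite_arcs.cut (edges G) src tgt X) \<noteq> 1"
proof
  interpret finite_arcs "edges G" src tgt
    by unfold_locales (use G(1) in \<open>simp add: finite_multigraph_def\<close>)
  assume "card (cut X) = 1"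
  then obtain e where e: "cut X = {e}" by (auto simp: card_1_singleton_iff)
  then have "e \<in> cut X" by simp
  then have eE: "e \<in> edges G" and cross: "(src e \<in> X) \<noteq> (tgt e \<in> X)" by (auto simp: cut_def)
  have same: "u \<in> X \<longleftrightarrow> v \<in> X" if "(u, v) \<in> (adjacency (delete_edge e G))\<^sup>*" for u v
    using that
  proof induction
    case (step y z)
    then obtain e' where e': "e' \<in> edges G" "e' \<noteq> e" "ends G e' = {y, z}"
      by (auto simp: adjacency_def delete_edge_def)
    then have "e' \<notin> cut X" using e by auto
    then have "src e' \<in> X \<longleftrightarrow> tgt e' \<in> X" using e'(1) by (simp add: cut_def)
    moreover have "{src e', tgt e'} = {y, z}" using ends[OF e'(1)] e'(3) by simp
    ultimately show ?case using step.IH by (auto simp: doubleton_eq_iff)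
  qed simp
  have "\<not> bridge G e" using G(2) eE by (simp add: bridgeless_def)
  then have "(src e, tgt e) \<in> (adjacency (delete_edge e G))\<^sup>*"
    using eE ends[OF eE] by (auto simp: bridge_def)
  from same[OF this] cross show False by blast
qed

theorem theorem6:
  fixes G :: "('v, 'e) multigraph"
  assumes "finite_multigraph G" and "bridgeless G"
  shows "flow_number TYPE(2) G \<le> ereal (1 + sqrt 5)"
proof -
  have "\<forall>e. \<exists>u v. e \<in> edges G \<longrightarrow> ends G e = {u, v}"
    using assms(1) unfolding finite_multigraph_def by blast
  then obtain src tgt where ends: "\<And>e. e \<in> edges G \<Longrightarrow> ends G e = {src e, tgt e}"
    by metis
  interpret finite_arcs "edges G" src tgt
    by unfold_locales (use assms(1) in \<open>simp add: finite_multigraph_def\<close>)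
  obtain f0 g0 where fg0: "\<And>v. 2 dvd net_out f0 {v}" "\<And>v. 3 dvd net_out g0 {v}"
    "\<And>e. e \<in> edges G \<Longrightarrow> \<not> 2 dvd f0 e \<or> \<not> 3 dvd g0 e"
    using six_flow[OF finite_E card_cut_bridgeless[OF assms ends]] by blast
  obtain f where f: "\<And>e. 2 dvd f0 e - f e" "\<And>e. \<bar>f e\<bar> < 2" "\<And>v. net_out f {v} = 0"
    using integer_flow_lift[of 2 f0] fg0(1) by auto
  obtain g where g: "\<And>e. 3 dvd g0 e - g e" "\<And>e. \<bar>g e\<bar> < 3" "\<And>v. net_out g {v} = 0"
    using integer_flow_lift[of 3 g0] fg0(2) by auto
  define D where "D = \<lparr>verts = vertices G, arcs = edges G, tail = src, head = tgt\<rparr>"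
  define \<phi> :: "'e \<Rightarrow> real ^ 2" where
    "\<phi> e = (\<chi> i. if i = 1 then of_int (f e) else of_int (g e))" for e
  have norm: "norm (\<phi> e) = sqrt (of_int ((f e)\<^sup>2 + (g e)\<^sup>2))" for e
    by (simp add: norm_vec_def L2_set_def sum_2 \<phi>_def)
  have range: "norm (\<phi> e) \<in> {1..1 + sqrt 5 - 1}" if "e \<in> edges G" for e
  proof -
    \<comment> \<open>The lifts keep the residues, so a common zero of \<open>f\<close> and
      \<open>g\<close> would be a common zero of \<open>f0\<close> modulo 2 and \<open>g0\<close>
      modulo 3.\<close>
    have "f e \<noteq> 0 \<or> g e \<noteq> 0" using fg0(3)[OF that] f(1)[of e] g(1)[of e] by auto
    moreover have "f e \<in> {-1, 0, 1}" "g e \<in> {-2, -1, 0, 1, 2}"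
      using f(2)[of e] g(2)[of e] by auto
    \<comment> \<open>The upper bound 5 comes from the extreme values 1 of
      \<open>\<bar>f e\<bar>\<close> and 2 of \<open>\<bar>g e\<bar>\<close>; integrality gives the
      lower bound.\<close>
    ultimately have "1 \<le> (f e)\<^sup>2 + (g e)\<^sup>2 \<and> (f e)\<^sup>2 + (g e)\<^sup>2 \<le> 5" by auto
    then have "(1 :: real) \<le> of_int ((f e)\<^sup>2 + (g e)\<^sup>2)" "of_int ((f e)\<^sup>2 + (g e)\<^sup>2) \<le> (5 :: real)"
      by linarith+
    then show ?thesis unfolding norm by simp
  qed
  have balance: "(\<Sum>e\<in>{e\<in>edges G. src e = v}. h e) = (\<Sum>e\<in>{e\<in>edges G. tgt e = v}. h e)"
    if "net_out h {v} = 0" for h v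
  proof -
    have "(\<Sum>e\<in>edges G. h e * of_bool (P e)) = (\<Sum>e\<in>{e\<in>edges G. P e}. h e)" for P
      using finite_E by (simp add: of_bool_def sum.If_cases Int_def if_distrib cong: if_cong)
    then show ?thesis
      using that by (simp add: net_out_def right_diff_distrib sum_subtractf)
  qed
  have conserve: "sum \<phi> (out_arcs D v) = sum \<phi> (in_arcs D v)" for v
  proof -
    have "sum \<phi> (out_arcs D v) $ i = sum \<phi> (in_arcs D v) $ i" for i
      using balance[OF f(3), of v] balance[OF g(3), of v]
      by (cases "i = 1") (simp_all add: \<phi>_def out_arcs_def in_arcs_def D_def flip: of_int_sum)
    then show ?thesis by (simp add: vec_eq_iff)
  qed
  have "orientation_of G D"
    using ends by (simp add: orientation_of_def D_def)
  then have "nowhere_zero_flow (1 + sqrt 5) G D \<phi>"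
    unfolding nowhere_zero_flow_def using range conserve by blast
  moreover have "2 \<le> 1 + sqrt 5" by simp
  ultimately show ?thesis
    unfolding flow_number_def by (intro Inf_lower) blast
qed

end
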